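(* Let $G$ be a totally disconnected locally compact group and let $\Gamma < G$ be a finitely generated lattice. Let $\widehat{\Sigma}$ be a compact generating set of $G$ and $\Sigma$ a finite generating set of $\Gamma$. Let $p \in [1,\infty)$ and assume that there is a Borel fundamental domain $\Omega \subset G$ for $G/\Gamma$ such that $$\int_\Omega \bigl( \| h \|_{\widehat{\Sigma}} \bigr)^p \, \mathrm{d}h < \infty .$$ If $\Gamma$ is undistorted in $G$, then $\Gamma$ is $p$-integrable.
   Context: A locally compact group $G$ containing a finitely generated lattice is compactly generated. $\|g\|_{\widehat{\Sigma}}$ denotes the word length of $g\in G$ with respect to $\widehat{\Sigma}$ and $d_{\widehat{\Sigma}}$ the associated word metric; $|\gamma|_\Sigma$ denotes the word length of $\gamma\in\Gamma$ with respect to $\Sigma$ and $d_\Sigma$ the associated word metric. Integration is with respect to Haar measure $\mathrm{d}h$ on $G$. The lattice $\Gamma$ is undistorted (or non-distorted) in $G$ if the inclusion $(\Gamma,d_\Sigma)\to(G,d_{\widehat{\Sigma}})$ is a quasi-isometric embedding. A Borel fundamental domain for $G/\Gamma$ is a Borel subset $\Omega\subset G$ with $G=\bigsqcup_{\gamma\in\Gamma}\Omega\gamma$. For $p\in[1,\infty)$, $\Gamma$ (or the inclusion $\Gamma<G$) is $p$-integrable if there is a Borel fundamental domain $\Omega'\subset G$ for $G/\Gamma$ such that for each $g\in G$ we have $\int_{\Omega'}\bigl(|\alpha(g,h)|_\Sigma\bigr)^p\,\mathrm{d}h<\infty$, where $\alpha:G\times\Omega'\to\Gamma$ is the induction cocycle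 defined by $\alpha(g,h)=\gamma \Leftrightarrow gh\gamma\in\Omega'$. *)

theory Defs
  imports "HOL-Analysis.Analysis"
begin

(* Topological groups are types of class topological_group_add. Despite the additive notation
   the group is not assumed to be abelian: g + h is the product gh, - g the inverse, 0 the
   identity, so left translation by g is (+) g and right translation by c is \<lambda>x. x + c. *)

definition add_subgroup :: "'g::group_add set \<Rightarrow> bool" where
  "add_subgroup H \<longleftrightarrow> 0 \<in> H \<and> (\<forall>x\<in>H. \<forall>y\<in>H. x + y \<in> H) \<and> (\<forall>x\<in>H. - x \<in> H)"

definition generates :: "'g::group_add set \<Rightarrow> 'g set \<Rightarrow> bool" where
  "generates S H \<longleftrightarrow> add_subgroup hull S = H"

(* The value is arbitrary when g does not lie in the subgroup generated by S. *)
definition word_length :: "'g::group_add set \<Rightarrow> 'g \<Rightarrow> nat" where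
  "word_length S g =
     (LEAST n. \<exists>xs. length xs = n \<and> set xs \<subseteq> S \<union> uminus ` S \<and> sum_list xs = g)"

definition word_dist :: "'g::group_add set \<Rightarrow> 'g \<Rightarrow> 'g \<Rightarrow> real" where
  "word_dist S x y = real (word_length S (- x + y))"

(* f is a quasi-isometric embedding of X with metric d into a set with metric e. *)
definition quasi_isometric_embedding ::
    "'a set \<Rightarrow> ('a \<Rightarrow> 'a \<Rightarrow> real) \<Rightarrow> ('b \<Rightarrow> 'b \<Rightarrow> real) \<Rightarrow> ('a \<Rightarrow> 'b) \<Rightarrow> bool" where
  "quasi_isometric_embedding X d e f \<longleftrightarrow>
     (\<exists>L\<ge>1. \<exists>C\<ge>0. \<forall>x\<in>X. \<forall>y\<in>X.
        d x y / L - C \<le> e (f x) (f y) \<and> e (f x) (f y) \<le> L * d x y + C)"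

definition undistorted :: "'g::group_add set \<Rightarrow> 'g set \<Rightarrow> 'g set \<Rightarrow> bool" where
  "undistorted \<Gamma> S K \<longleftrightarrow> quasi_isometric_embedding \<Gamma> (word_dist S) (word_dist K) (\<lambda>\<gamma>. \<gamma>)"

definition totally_disconnected :: "'a::topological_space set \<Rightarrow> bool" where
  "totally_disconnected X \<longleftrightarrow> (\<forall>x\<in>X. connected_component_set X x = {x})"

(* Outer regular on Borel sets, inner regular on open sets. *)
definition radon_measure :: "'a topology \<Rightarrow> 'a measure \<Rightarrow> bool" where
  "radon_measure T \<mu> \<longleftrightarrow>
     space \<mu> = topspace T \<and>
     sets \<mu> = sigma_sets (topspace T) {U. openin T U} \<and>
     (\<forall>K. compactin T K \<longrightarrow> emeasure \<mu> K < \<infinity>) \<and>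
     (\<forall>A\<in>sets \<mu>. emeasure \<mu> A = (INF U\<in>{U. openin T U \<and> A \<subseteq> U}. emeasure \<mu> U)) \<and>
     (\<forall>U. openin T U \<longrightarrow> emeasure \<mu> U = (SUP K\<in>{K. compactin T K \<and> K \<subseteq> U}. emeasure \<mu> K))"

definition left_haar_measure :: "'g::topological_group_add measure \<Rightarrow> bool" where
  "left_haar_measure m \<longleftrightarrow>
     radon_measure euclidean m \<and> emeasure m UNIV \<noteq> 0 \<and>
     (\<forall>g. \<forall>A\<in>sets m. emeasure m ((+) g ` A) = emeasure m A)"

definition left_coset :: "'g::group_add set \<Rightarrow> 'g \<Rightarrow> 'g set" where
  "left_coset \<Gamma> g = (+) g ` \<Gamma>"

(* The quotient topology on G/\<Gamma>, whose points are the left cosets of \<Gamma>. *)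
definition coset_topology :: "'g::topological_group_add set \<Rightarrow> 'g set topology" where
  "coset_topology \<Gamma> = topology (\<lambda>U. U \<subseteq> range (left_coset \<Gamma>) \<and> open (left_coset \<Gamma> -` U))"

lemma openin_coset_topology:
  "openin (coset_topology \<Gamma>) U \<longleftrightarrow> U \<subseteq> range (left_coset \<Gamma>) \<and> open (left_coset \<Gamma> -` U)"
proof -
  have "istopology (\<lambda>U. U \<subseteq> range (left_coset \<Gamma>) \<and> open (left_coset \<Gamma> -` U))"
    unfolding istopology_def
  proof (intro conjI allI impI)
    fix \<U> assume U: "\<forall>U\<in>\<U>. U \<subseteq> range (left_coset \<Gamma>) \<and> open (left_coset \<Gamma> -` U)"
    show "\<Union>\<U> \<subseteq> range (left_coset \<Gamma>)"
      using U by blast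
    show "open (left_coset \<Gamma> -` \<Union>\<U>)"
      unfolding vimage_Union using U by (intro open_UN) blast
  qed (simp_all add: le_infI1 open_Int)
  then show ?thesis
    by (simp add: coset_topology_def topology_inverse')
qed

lemma quotient_map_left_coset: "quotient_map euclidean (coset_topology \<Gamma>) (left_coset \<Gamma>)"
proof -
  have "topspace (coset_topology \<Gamma>) = range (left_coset \<Gamma>)"
  proof (rule antisym)
    show "topspace (coset_topology \<Gamma>) \<subseteq> range (left_coset \<Gamma>)"
      using openin_topspace openin_coset_topology by blast
    have "left_coset \<Gamma> -` range (left_coset \<Gamma>) = UNIV"
      by blast
    then have "openin (coset_topology \<Gamma>) (range (left_coset \<Gamma>))"
      by (simp add: openin_coset_topology)
    then show "range (left_coset \<Gamma>) \<subseteq> topspace (coset_topology \<Gamma>)"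
      by (rule openin_subset)
  qed
  then show ?thesis
    by (simp add: quotient_map_def openin_coset_topology vimage_def)
qed

(* An element g acts on G/\<Gamma> by translating cosets, C \<mapsto> (+) g ` C. *)
definition lattice_subgroup :: "'g::topological_group_add set \<Rightarrow> bool" where
  "lattice_subgroup \<Gamma> \<longleftrightarrow>
     add_subgroup \<Gamma> \<and> discrete \<Gamma> \<and>
     (\<exists>\<mu>. radon_measure (coset_topology \<Gamma>) \<mu> \<and>
          emeasure \<mu> (space \<mu>) \<noteq> 0 \<and> emeasure \<mu> (space \<mu>) < \<infinity> \<and>
          (\<forall>g. \<forall>A\<in>sets \<mu>. emeasure \<mu> ((\<lambda>C. (+) g ` C) ` A) = emeasure \<mu> A))"

definition borel_fundamental_domain :: "'g::topological_group_add set \<Rightarrow> 'g set \<Rightarrow> bool" where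
  "borel_fundamental_domain \<Gamma> \<Omega> \<longleftrightarrow>
     \<Omega> \<in> sets borel \<and>
     (\<Union>\<gamma>\<in>\<Gamma>. (\<lambda>x. x + \<gamma>) ` \<Omega>) = UNIV \<and>
     disjoint_family_on (\<lambda>\<gamma>. (\<lambda>x. x + \<gamma>) ` \<Omega>) \<Gamma>"

(* Well defined when \<Omega> is a fundamental domain, as the translates of \<Omega> then partition G. *)
definition induction_cocycle :: "'g::group_add set \<Rightarrow> 'g set \<Rightarrow> 'g \<Rightarrow> 'g \<Rightarrow> 'g" where
  "induction_cocycle \<Gamma> \<Omega> g h = (THE \<gamma>. \<gamma> \<in> \<Gamma> \<and> g + h + \<gamma> \<in> \<Omega>)"

(* m is a Haar measure on G and S a finite generating set of \<Gamma>; rescaling m or changing S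
   does not affect the condition. *)
definition p_integrable ::
    "'g::topological_group_add measure \<Rightarrow> 'g set \<Rightarrow> 'g set \<Rightarrow> real \<Rightarrow> bool" where
  "p_integrable m \<Gamma> S p \<longleftrightarrow>
     (\<exists>\<Omega>. borel_fundamental_domain \<Gamma> \<Omega> \<and>
        (\<forall>g. (\<integral>\<^sup>+h\<in>\<Omega>. ennreal (real (word_length S (induction_cocycle \<Gamma> \<Omega> g h)) powr p) \<partial>m) < \<infinity>))"

end

theory Submission
  imports Defs
begin

text \<open>
  Write \<open>\<bar>x\<bar>\<close> for the word length over \<open>K\<close>. For \<open>h\<close> in \<open>\<Omega>\<close> let \<open>T h = g + h + \<alpha> h\<close>, with
  \<open>\<alpha> h = induction_cocycle \<Gamma> \<Omega> g h\<close>, be the representative in \<open>\<Omega>\<close> of the coset of \<open>g + h\<close>.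
  Since \<open>\<alpha> h = - h + (- g + T h)\<close>, we have \<open>\<bar>\<alpha> h\<bar> \<le> \<bar>h\<bar> + \<bar>g\<bar> + \<bar>T h\<bar>\<close>, and as \<open>\<Gamma>\<close> is
  undistorted the same bound holds over \<open>S\<close> up to constants. So \<open>\<Omega>\<close> itself is the required fundamental
  domain as soon as the \<open>p\<close>-th powers of the three summands are integrable on \<open>\<Omega>\<close>. For \<open>\<bar>h\<bar>\<close> this is
  the hypothesis. A constant is integrable because \<open>\<bar>h\<bar> \<ge> 1\<close> away from \<open>0\<close>, so that the hypothesis
  also bounds the measure of \<open>\<Omega>\<close>. For \<open>\<bar>T h\<bar>\<close> one uses that \<open>T\<close> preserves the Haar measure of \<open>\<Omega>\<close>
  (\<open>nn_integral_induced_action\<close>), which reduces this integral to the first one. On each of countably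
  many pieces \<open>T\<close> is a left translation followed by a right translation by an element of \<open>\<Gamma>\<close>;
  hence everything rests on the invariance of the left Haar measure \<open>m\<close> under right translation by \<open>\<Gamma>\<close>
  (\<open>haar_measure_right_invariant_lattice\<close>).

  That invariance is a case of the unimodularity of groups with a lattice, and total disconnectedness
  gives a proof by counting cosets. By van Dantzig's theorem the compact open subgroups form a
  neighbourhood basis of \<open>0\<close>, and a Radon measure is determined by its values on their cosets. Let \<open>V\<close> be one
  that meets \<open>\<Gamma>\<close> only in \<open>0\<close>, let \<open>c\<close> be in \<open>\<Gamma>\<close> and let \<open>V'\<close> be the conjugate of \<open>V\<close> by \<open>c\<close>. Both
  subgroups embed in \<open>G/\<Gamma>\<close>, and since \<open>c\<close> fixes the base point their images are translates of each other,
  so that the invariant measure \<open>\<mu>\<close> on \<open>G/\<Gamma>\<close> gives them the same mass. Cutting both into cosets of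
  \<open>V \<inter> V'\<close> shows first, with \<open>\<mu>\<close>, that this intersection has the same index in \<open>V\<close> and in \<open>V'\<close>, and then,
  with \<open>m\<close>, that \<open>V\<close> and \<open>V'\<close> have the same Haar measure
  (\<open>haar_measure_lattice_conjugate\<close>).
\<close>

section \<open>Cosets and translates in topological groups\<close>

lemma add_subgroupD:
  assumes "add_subgroup H"
  shows "0 \<in> H" and "x \<in> H \<Longrightarrow> y \<in> H \<Longrightarrow> x + y \<in> H" and "x \<in> H \<Longrightarrow> - x \<in> H"
  using assms by (auto simp: add_subgroup_def)

lemma mem_left_coset: "y \<in> left_coset H x \<longleftrightarrow> - x + y \<in> H"
proof
  assume "- x + y \<in> H"
  moreover have "y = x + (- x + y)" by (simp flip: add.assoc)
  ultimately show "y \<in> left_coset H x" unfolding left_coset_def by (rule rev_image_eqI)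
qed (auto simp: left_coset_def simp flip: add.assoc)

lemma left_coset_eq_iff:
  assumes "add_subgroup H"
  shows "left_coset H x = left_coset H y \<longleftrightarrow> - x + y \<in> H"
proof
  assume "left_coset H x = left_coset H y"
  then show "- x + y \<in> H"
    using add_subgroupD(1)[OF assms] by (metis left_minus mem_left_coset)
next
  assume xy: "- x + y \<in> H"
  then have yx: "- y + x \<in> H"
    using add_subgroupD(3)[OF assms xy] by (simp add: minus_add)
  show "left_coset H x = left_coset H y"
  proof (intro set_eqI)
    fix z
    have "- x + z = (- x + y) + (- y + z)" "- y + z = (- y + x) + (- x + z)"
      by (simp_all add: add.assoc)
    then show "z \<in> left_coset H x \<longleftrightarrow> z \<in> left_coset H y"
      using add_subgroupD(2)[OF assms] xy yx by (metis mem_left_coset)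
  qed
qed

lemma left_cosets_disjoint:
  assumes "add_subgroup H" "z \<in> left_coset H x" "z \<in> left_coset H y"
  shows "left_coset H x = left_coset H y"
proof -
  have "left_coset H x = left_coset H z" "left_coset H y = left_coset H z"
    using assms(2,3) by (simp_all add: left_coset_eq_iff[OF assms(1)] mem_left_coset)
  then show ?thesis by simp
qed

lemma self_in_left_coset: "add_subgroup H \<Longrightarrow> x \<in> left_coset H x"
  by (simp add: mem_left_coset add_subgroup_def)

text \<open>Translation by \<open>x\<close> is invertible, so a coset is also a preimage; this form passes
  openness through the continuity of translation.\<close>

lemma left_coset_vimage: "left_coset H x = (\<lambda>y. - x + y) -` H"
  by (auto simp: mem_left_coset)

lemma right_translate_vimage: "(\<lambda>x. x + c) ` A = (\<lambda>x. x + - c) -` (A::'g::group_add set)"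
proof (intro equalityI subsetI)
  fix y assume "y \<in> (\<lambda>x. x + - c) -` A"
  then show "y \<in> (\<lambda>x. x + c) ` A" by (intro image_eqI[of _ _ "y + - c"]) (auto simp: add.assoc)
qed (auto simp: add.assoc)

lemma open_right_translate:
  fixes U :: "'g::topological_group_add set"
  assumes "open U" shows "open ((\<lambda>x. x + c) ` U)"
  unfolding right_translate_vimage by (intro open_vimage assms continuous_intros)

lemma open_left_coset:
  fixes U :: "'g::topological_group_add set"
  assumes "open U" shows "open (left_coset U x)"
  unfolding left_coset_vimage by (intro open_vimage assms continuous_intros)

lemma open_subgroupI:
  fixes H :: "'g::topological_group_add set"
  assumes H: "add_subgroup H" and N: "open N" "0 \<in> N" "N \<subseteq> H"
  shows "open H"
proof (subst open_subopen, intro ballI)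
  fix x assume x: "x \<in> H"
  have "left_coset N x \<subseteq> H"
    using add_subgroupD(2)[OF H x] N(3) by (auto simp: left_coset_def)
  then show "\<exists>T. open T \<and> x \<in> T \<and> T \<subseteq> H"
    using open_left_coset[OF N(1), of x] N(2) by (intro exI[of _ "left_coset N x"]) (auto simp: mem_left_coset)
qed

text \<open>The complement of a subgroup is a union of its cosets.\<close>

lemma open_subgroup_closed:
  fixes H :: "'g::topological_group_add set"
  assumes H: "add_subgroup H" and "open H"
  shows "closed H"
proof -
  have "- H = (\<Union>x\<in>-H. left_coset H x)"
  proof (intro equalityI subsetI)
    fix y assume "y \<in> (\<Union>x\<in>-H. left_coset H x)"
    then obtain x where x: "x \<notin> H" "- x + y \<in> H" by (auto simp: mem_left_coset)
    show "y \<in> - H"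
    proof
      assume "y \<in> H"
      then have "y + - (- x + y) \<in> H"
        using x(2) add_subgroupD[OF H] by blast
      then show False using x(1) by (simp add: minus_add flip: add.assoc)
    qed
  qed (use self_in_left_coset[OF H] in auto)
  moreover have "open (\<Union>x\<in>-H. left_coset H x)"
    using open_left_coset[OF assms(2)] by blast
  ultimately show ?thesis by (simp add: closed_def)
qed

text \<open>The tube lemma for addition, which is continuous at all points \<open>(x, 0)\<close> with \<open>x\<close> in \<open>C\<close>: a compact set can be
  thickened uniformly inside an open one.\<close>

lemma compact_plus_neighbourhood:
  fixes C :: "'g::topological_group_add set"
  assumes "compact C" "open U" "C \<subseteq> U"
  obtains N where "open N" "0 \<in> N" "\<And>x n. x \<in> C \<Longrightarrow> n \<in> N \<Longrightarrow> x + n \<in> U"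
proof -
  have "open ((\<lambda>z. snd z + fst z) -` U :: ('g \<times> 'g) set)"
    by (intro open_vimage assms continuous_intros)
  moreover have "{0} \<times> C \<subseteq> (\<lambda>z. snd z + fst z) -` U"
    using assms(3) by auto
  ultimately have "\<exists>N. 0 \<in> N \<and> open N \<and> N \<times> C \<subseteq> (\<lambda>z. snd z + fst z) -` U"
    by (rule Elementary_Topology.tube_lemma[OF assms(1)])
  then obtain N where "0 \<in> N" "open N" "N \<times> C \<subseteq> (\<lambda>z. snd z + fst z) -` U"
    by blast
  then show ?thesis by (intro that[of N]) auto
qed

section \<open>Compact open subgroups\<close>

text \<open>Inside a compact neighbourhood \<open>C\<close> of \<open>x\<close> the components are still points, so the cut-wire theorem separates \<open>x\<close>
  from the points of \<open>C\<close> outside \<open>N \<inter> T\<close>, where \<open>N\<close> is an open set between \<open>x\<close> and \<open>C\<close>. The piece that contains \<open>x\<close>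
  is open in \<open>C\<close> and lies in \<open>N\<close>, hence is open in the whole space.\<close>

lemma compact_open_neighbourhood:
  fixes x :: "'a::t2_space"
  assumes lc: "locally_compact_space (euclidean :: 'a topology)"
    and td: "totally_disconnected (UNIV :: 'a set)"
    and T: "open T" "x \<in> T"
  obtains U where "compact U" "open U" "x \<in> U" "U \<subseteq> T"
proof -
  obtain N C where N: "open N" "compact C" "x \<in> N" "N \<subseteq> C"
    using lc unfolding locally_compact_space_def by (simp, metis)
  have Ccl: "closed C" using N(2) by (rule compact_imp_closed)
  have sep: "separated_between (top_of_set C) {x} (C - (N \<inter> T))"
  proof (rule cut_wire_fence_theorem)
    show "compact_space (top_of_set C)"
      using N(2) by (simp add: compact_space_subtopology)
    have "Hausdorff_space (euclidean :: 'a topology)"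
      unfolding Hausdorff_space_def disjnt_def by (simp add: separation_t2)
    then show "Hausdorff_space (top_of_set C)"
      by (rule Hausdorff_space_subtopology)
    show "closedin (top_of_set C) {x}"
      using N by (intro closed_subset) auto
    show "closedin (top_of_set C) (C - (N \<inter> T))"
      using N(1) T(1) Ccl by (intro closed_subset closed_Diff open_Int) auto
    fix D assume D: "connectedin (top_of_set C) D"
    show "disjnt D {x} \<or> disjnt D (C - (N \<inter> T))"
    proof (cases "x \<in> D")
      case True
      have "connected D" using D by (simp add: connectedin_subtopology)
      then have "D \<subseteq> connected_component_set UNIV x"
        using True by (intro connected_component_maximal) auto
      then have "D \<subseteq> {x}" using td by (simp add: totally_disconnected_def)
      then show ?thesis using N T by (auto simp: disjnt_def)
    qed (auto simp: disjnt_def)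
  qed
  then obtain U where U: "closedin (top_of_set C) U" "openin (top_of_set C) U" "x \<in> U"
      "U \<inter> (C - (N \<inter> T)) = {}"
    unfolding separated_between by auto
  have UC: "U \<subseteq> C" using U(2) openin_imp_subset by blast
  show ?thesis
  proof
    show "compact U"
      using U(1) N(2) closedin_compact by blast
    obtain W where W: "open W" "U = C \<inter> W"
      using U(2) by (auto simp: openin_open)
    then have "U = N \<inter> W" using U(4) N(4) by blast
    then show "open U" using N(1) W(1) by (simp add: open_Int)
    show "x \<in> U" "U \<subseteq> T" using U UC by auto
  qed
qed

definition compact_open_subgroup :: "'g::topological_group_add set \<Rightarrow> bool" where
  "compact_open_subgroup V \<longleftrightarrow> add_subgroup V \<and> compact V \<and> open V"

text \<open>A compact open neighbourhood \<open>U\<close> of \<open>0\<close> absorbs a small neighbourhood of \<open>0\<close> on the right, so its right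
  stabiliser is open. The stabiliser is a subgroup, lies in \<open>U\<close> because \<open>0\<close> does, and is closed because open
  subgroups are.\<close>

theorem van_Dantzig:
  fixes T :: "'g :: {topological_group_add, t2_space} set"
  assumes lc: "locally_compact_space (euclidean :: 'g topology)"
    and td: "totally_disconnected (UNIV :: 'g set)"
    and T: "open T" "0 \<in> T"
  obtains V where "compact_open_subgroup V" "V \<subseteq> T"
proof -
  obtain U where U: "compact U" "open U" "0 \<in> U" "U \<subseteq> T"
    using compact_open_neighbourhood[OF lc td T] .
  obtain N where N: "open N" "0 \<in> N" "\<And>x n. x \<in> U \<Longrightarrow> n \<in> N \<Longrightarrow> x + n \<in> U"
    using compact_plus_neighbourhood[OF U(1,2)] by blast
  \<comment> \<open>The right stabiliser of \<open>U\<close>: both conditions together say that \<open>U + x = U\<close>.\<close>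
  define V where "V = {x. \<forall>u\<in>U. u + x \<in> U \<and> u + - x \<in> U}"
  have V: "add_subgroup V"
  proof -
    have "u + (x + y) \<in> U \<and> u + - (x + y) \<in> U" if "x \<in> V" "y \<in> V" "u \<in> U" for u x y
    proof -
      have "u + (x + y) = (u + x) + y" "u + - (x + y) = (u + - y) + - x"
        by (simp_all only: minus_add add.assoc)
      then show ?thesis using that unfolding V_def mem_Collect_eq by (simp only:)
    qed
    then show ?thesis unfolding add_subgroup_def by (auto simp: V_def)
  qed
  have VU: "V \<subseteq> U" using U(3) by (force simp: V_def)
  have "open V"
  proof (rule open_subgroupI[OF V])
    show "open (N \<inter> uminus -` N)"
      by (intro open_Int N open_vimage continuous_intros)
    show "0 \<in> N \<inter> uminus -` N" "N \<inter> uminus -` N \<subseteq> V"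
      using N by (auto simp: V_def simp del: add_uminus_conv_diff)
  qed
  moreover have "compact V"
    using compact_Int_closed[OF U(1) open_subgroup_closed[OF V \<open>open V\<close>]] VU
    by (simp add: Int_absorb1)
  ultimately show ?thesis using that V VU U(4) by (auto simp: compact_open_subgroup_def)
qed

lemma compact_open_subgroup_Int:
  fixes V W :: "'g :: {topological_group_add, t2_space} set"
  assumes "compact_open_subgroup V" "compact_open_subgroup W"
  shows "compact_open_subgroup (V \<inter> W)"
proof -
  have "add_subgroup (V \<inter> W)"
    using assms unfolding compact_open_subgroup_def add_subgroup_def by fast
  then show ?thesis
    using assms by (simp add: compact_open_subgroup_def compact_Int open_Int)
qed

lemma compact_open_subgroup_conjugate:
  fixes V :: "'g :: topological_group_add set"
  assumes V: "compact_open_subgroup V"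
  shows "compact_open_subgroup ((\<lambda>x. - c + x + c) ` V)"
proof -
  have eq: "(\<lambda>x. - c + x + c) ` V = (\<lambda>x. c + x + - c) -` V"
  proof (intro set_eqI iffI)
    fix y assume "y \<in> (\<lambda>x. c + x + - c) -` V"
    moreover have "y = - c + (c + y + - c) + c" by (simp only: add.assoc minus_add_cancel left_minus add_0_right)
    ultimately show "y \<in> (\<lambda>x. - c + x + c) ` V" by blast
  qed (auto simp: add.assoc)
  have "compact ((\<lambda>x. - c + x + c) ` V)"
    using V by (intro compact_continuous_image continuous_intros) (auto simp: compact_open_subgroup_def)
  moreover have "open ((\<lambda>x. c + x + - c) -` V)"
    using V by (intro open_vimage continuous_intros) (auto simp: compact_open_subgroup_def)
  moreover have "add_subgroup ((\<lambda>x. c + x + - c) -` V)"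
  proof -
    have Vs: "add_subgroup V" using V by (simp add: compact_open_subgroup_def)
    have plus: "c + (x + y) + - c = (c + x + - c) + (c + y + - c)" for x y
      by (simp only: add.assoc minus_add_cancel)
    have minus: "c + - x + - c = - (c + x + - c)" for x
      by (simp only: minus_add add.assoc minus_minus)
    show ?thesis
      unfolding add_subgroup_def vimage_def mem_Collect_eq plus minus
      using add_subgroupD[OF Vs] by (simp del: add_uminus_conv_diff)
  qed
  ultimately show ?thesis by (simp add: compact_open_subgroup_def eq)
qed

section \<open>Counting cosets with a measure\<close>

lemma finite_left_cosets:
  fixes V :: "'g :: topological_group_add set"
  assumes V: "add_subgroup V" "open V" and C: "compact C"
  shows "finite (left_coset V ` C)"
proof -
  have "C \<subseteq> (\<Union>x\<in>C. left_coset V x)" using self_in_left_coset[OF V(1)] by blast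
  then obtain F where F: "F \<subseteq> C" "finite F" "C \<subseteq> (\<Union>x\<in>F. left_coset V x)"
    using compactE_image[OF C, of C "left_coset V"] open_left_coset[OF V(2)] by blast
  have "left_coset V ` C \<subseteq> left_coset V ` F"
  proof (rule image_subsetI)
    fix x assume "x \<in> C"
    then obtain y where "y \<in> F" "x \<in> left_coset V y" using F(3) by blast
    then show "left_coset V x \<in> left_coset V ` F"
      using left_cosets_disjoint[OF V(1) self_in_left_coset[OF V(1)]] by blast
  qed
  then show ?thesis using F(2) finite_subset by blast
qed

text \<open>The map \<open>f\<close> is the identity when \<open>N\<close> is the Haar measure, the quotient map when \<open>N\<close> lives on the coset space,
  and a right translation in the final comparison of measures.\<close>

lemma emeasure_UN_left_cosets:
  fixes V :: "'g :: topological_group_add set"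
  assumes V: "add_subgroup V" "open V" and C: "compact C"
    and inj: "inj_on f (\<Union>x\<in>C. left_coset V x)"
    and sets: "\<And>x. x \<in> C \<Longrightarrow> f ` left_coset V x \<in> sets N"
    and eq: "\<And>x. x \<in> C \<Longrightarrow> emeasure N (f ` left_coset V x) = a"
  shows "emeasure N (f ` (\<Union>x\<in>C. left_coset V x)) = of_nat (card (left_coset V ` C)) * a"
proof -
  have "disjoint_family_on ((`) f) (left_coset V ` C)"
    unfolding disjoint_family_on_def
  proof (intro ballI impI)
    fix P Q assume *: "P \<in> left_coset V ` C" "Q \<in> left_coset V ` C" "P \<noteq> Q"
    then have "P \<inter> Q = {}" using left_cosets_disjoint[OF V(1)] by blast
    then show "f ` P \<inter> f ` Q = {}"
      using inj_on_image_Int[OF inj, of P Q] * by auto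
  qed
  then have "(\<Sum>P\<in>left_coset V ` C. emeasure N (f ` P)) = emeasure N (\<Union>P\<in>left_coset V ` C. f ` P)"
    using sets finite_left_cosets[OF V C] by (intro sum_emeasure) auto
  moreover have "(\<Union>P\<in>left_coset V ` C. f ` P) = f ` (\<Union>x\<in>C. left_coset V x)" by auto
  moreover have "(\<Sum>P\<in>left_coset V ` C. emeasure N (f ` P)) = (\<Sum>P\<in>left_coset V ` C. a)"
    using eq by (intro sum.cong) auto
  ultimately show ?thesis by simp
qed

section \<open>Right invariance of Haar measure under a lattice\<close>

lemma radon_measureD:
  assumes "radon_measure T \<mu>"
  shows "space \<mu> = topspace T"
    and "sets \<mu> = sigma_sets (topspace T) {U. openin T U}"
    and "compactin T C \<Longrightarrow> emeasure \<mu> C < \<infinity>"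
    and "A \<in> sets \<mu> \<Longrightarrow> emeasure \<mu> A = (INF U\<in>{U. openin T U \<and> A \<subseteq> U}. emeasure \<mu> U)"
    and "openin T U \<Longrightarrow> emeasure \<mu> U = (SUP C\<in>{C. compactin T C \<and> C \<subseteq> U}. emeasure \<mu> C)"
  using assms unfolding radon_measure_def by blast+

lemma radon_measure_openin_sets:
  assumes "radon_measure T \<mu>" "openin T U"
  shows "U \<in> sets \<mu>"
  using assms(2) unfolding radon_measureD(2)[OF assms(1)] by (intro sigma_sets.Basic CollectI)

lemma borel_right_translate:
  fixes A :: "'g::topological_group_add set"
  assumes "A \<in> sets borel"
  shows "(\<lambda>x. x + c) ` A \<in> sets borel"
proof -
  have "(\<lambda>x. x + - c) \<in> borel_measurable (borel :: 'g measure)"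
    by (intro borel_measurable_continuous_onI continuous_intros)
  from measurable_sets[OF this assms] show ?thesis
    by (simp add: right_translate_vimage)
qed

text \<open>The quotient map is open: the saturation of an open set is a union of right translates of it.\<close>

lemma openin_coset_image:
  fixes V \<Gamma> :: "'g::topological_group_add set"
  assumes G: "add_subgroup \<Gamma>" and V: "open V"
  shows "openin (coset_topology \<Gamma>) (left_coset \<Gamma> ` V)"
proof -
  have "left_coset \<Gamma> -` (left_coset \<Gamma> ` V) = (\<Union>c\<in>\<Gamma>. (\<lambda>x. x + c) ` V)"
  proof (intro equalityI subsetI)
    fix y assume "y \<in> left_coset \<Gamma> -` (left_coset \<Gamma> ` V)"
    then obtain v where v: "v \<in> V" "left_coset \<Gamma> v = left_coset \<Gamma> y" by force
    then have "- v + y \<in> \<Gamma>" by (simp add: left_coset_eq_iff[OF G])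
    moreover have "y = v + (- v + y)" by (simp flip: add.assoc)
    ultimately show "y \<in> (\<Union>c\<in>\<Gamma>. (\<lambda>x. x + c) ` V)" using v(1) by blast
  next
    fix y assume "y \<in> (\<Union>c\<in>\<Gamma>. (\<lambda>x. x + c) ` V)"
    then obtain v c where v: "v \<in> V" "c \<in> \<Gamma>" "y = v + c" by blast
    then have "left_coset \<Gamma> v = left_coset \<Gamma> y"
      by (simp add: left_coset_eq_iff[OF G] flip: add.assoc)
    then show "y \<in> left_coset \<Gamma> -` (left_coset \<Gamma> ` V)" using v(1) by blast
  qed
  then show ?thesis
    using V by (auto simp: openin_coset_topology open_right_translate)
qed

lemma translate_left_coset: "(+) g ` left_coset H x = left_coset H (g + x)"
  by (auto simp: left_coset_def image_image add.assoc)

lemma translate_coset_image: "(\<lambda>C. (+) g ` C) ` left_coset H ` A = left_coset H ` (+) g ` A"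
  by (simp add: image_image translate_left_coset)

lemma inj_on_left_coset:
  assumes "add_subgroup \<Gamma>" "add_subgroup V" "V \<inter> \<Gamma> = {0}"
  shows "inj_on (left_coset \<Gamma>) V"
proof (rule inj_onI)
  fix x y assume xy: "x \<in> V" "y \<in> V" "left_coset \<Gamma> x = left_coset \<Gamma> y"
  then have "- x + y \<in> V \<inter> \<Gamma>"
    using add_subgroupD(2,3)[OF assms(2)] by (simp add: left_coset_eq_iff[OF assms(1)])
  then have "- x + y = 0" using assms(3) by blast
  then show "x = y" by (metis add_eq_0_iff2 neg_equal_iff_equal)
qed

text \<open>The defining properties of a Haar measure, with sets and compactness stated for the type class topology.\<close>

lemma left_haarD:
  fixes m :: "'g::{topological_group_add,t2_space} measure"
  assumes "left_haar_measure m"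
  shows "sets m = sets borel" "space m = UNIV" "compact C \<Longrightarrow> emeasure m C < \<infinity>"
    "A \<in> sets borel \<Longrightarrow> emeasure m (left_coset A g) = emeasure m A"
    "A \<in> sets borel \<Longrightarrow> emeasure m A = (INF U\<in>{U. open U \<and> A \<subseteq> U}. emeasure m U)"
    "open U \<Longrightarrow> emeasure m U = (SUP C\<in>{C. compact C \<and> C \<subseteq> U}. emeasure m C)"
proof -
  have r: "radon_measure euclidean m" using assms by (simp add: left_haar_measure_def)
  show 1: "sets m = sets borel" and "space m = UNIV"
    using radon_measureD(1,2)[OF r] by (simp_all add: borel_def sets_measure_of)
  show "compact C \<Longrightarrow> emeasure m C < \<infinity>"
    using radon_measureD(3)[OF r] by simp
  show "A \<in> sets borel \<Longrightarrow> emeasure m (left_coset A g) = emeasure m A"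
    using assms by (simp add: left_haar_measure_def 1 left_coset_def)
  show "A \<in> sets borel \<Longrightarrow> emeasure m A = (INF U\<in>{U. open U \<and> A \<subseteq> U}. emeasure m U)"
    using radon_measureD(4)[OF r, of A] by (simp only: 1 open_openin)
  show "open U \<Longrightarrow> emeasure m U = (SUP C\<in>{C. compact C \<and> C \<subseteq> U}. emeasure m C)"
    using radon_measureD(5)[OF r, of U] by (simp only: compactin_euclidean_iff open_openin)
qed

lemma UN_left_cosets_subgroup:
  assumes V: "add_subgroup V" and W: "add_subgroup W" "W \<subseteq> V"
  shows "(\<Union>x\<in>V. left_coset W x) = V"
proof
  show "(\<Union>x\<in>V. left_coset W x) \<subseteq> V"
    using add_subgroupD(2)[OF V] W(2) by (auto simp: left_coset_def)
  show "V \<subseteq> (\<Union>x\<in>V. left_coset W x)"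
    using self_in_left_coset[OF W(1)] by blast
qed

definition coset_index :: "'g::group_add set \<Rightarrow> 'g set \<Rightarrow> nat" where
  "coset_index V W = card (left_coset W ` V)"

lemma haar_measure_index:
  fixes m :: "'g::{topological_group_add,t2_space} measure"
  assumes m: "left_haar_measure m"
    and V: "compact_open_subgroup V" and W: "compact_open_subgroup W" "W \<subseteq> V"
  shows "emeasure m V = of_nat (coset_index V W) * emeasure m W"
proof -
  have "emeasure m ((\<lambda>x. x) ` (\<Union>x\<in>V. left_coset W x)) = of_nat (card (left_coset W ` V)) * emeasure m W"
    using V W left_haarD(1,4)[OF m] open_left_coset[of W]
    by (intro emeasure_UN_left_cosets) (auto simp: compact_open_subgroup_def)
  then show ?thesis
    using V W by (simp add: coset_index_def UN_left_cosets_subgroup compact_open_subgroup_def)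
qed

text \<open>A subgroup that meets \<open>\<Gamma>\<close> only in \<open>0\<close> embeds in the coset space, and an invariant measure there does not
  distinguish the images of the cosets of \<open>W\<close>, as they are translates of one another.\<close>

lemma quotient_measure_index:
  fixes \<Gamma> :: "'g::{topological_group_add,t2_space} set"
  assumes G: "add_subgroup \<Gamma>" and \<mu>: "radon_measure (coset_topology \<Gamma>) \<mu>"
    and inv: "\<And>g A. A \<in> sets \<mu> \<Longrightarrow> emeasure \<mu> ((\<lambda>C. (+) g ` C) ` A) = emeasure \<mu> A"
    and V: "compact_open_subgroup V" "V \<inter> \<Gamma> = {0}" and W: "compact_open_subgroup W" "W \<subseteq> V"
  shows "emeasure \<mu> (left_coset \<Gamma> ` V) = of_nat (coset_index V W) * emeasure \<mu> (left_coset \<Gamma> ` W)"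
proof -
  have UN: "(\<Union>x\<in>V. left_coset W x) = V"
    using V W by (simp add: UN_left_cosets_subgroup compact_open_subgroup_def)
  have sets: "left_coset \<Gamma> ` U \<in> sets \<mu>" if "open U" for U
    by (rule radon_measure_openin_sets[OF \<mu> openin_coset_image[OF G that]])
  have "emeasure \<mu> (left_coset \<Gamma> ` (\<Union>x\<in>V. left_coset W x))
      = of_nat (card (left_coset W ` V)) * emeasure \<mu> (left_coset \<Gamma> ` W)"
  proof (rule emeasure_UN_left_cosets)
    show "inj_on (left_coset \<Gamma>) (\<Union>x\<in>V. left_coset W x)"
      unfolding UN using G V by (intro inj_on_left_coset) (auto simp: compact_open_subgroup_def)
    fix x
    show "left_coset \<Gamma> ` left_coset W x \<in> sets \<mu>"
      using W by (intro sets open_left_coset) (auto simp: compact_open_subgroup_def)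
    show "emeasure \<mu> (left_coset \<Gamma> ` left_coset W x) = emeasure \<mu> (left_coset \<Gamma> ` W)"
      using inv[OF sets, of W x] W
      by (simp add: translate_coset_image compact_open_subgroup_def) (simp add: left_coset_def)
  qed (use V W in \<open>auto simp: compact_open_subgroup_def\<close>)
  then show ?thesis by (simp add: UN coset_index_def)
qed

text \<open>If the image of a neighbourhood of \<open>0\<close> were null, so would be all its translates. Finitely many of them cover any
  given compact set, so inner regularity would make the whole space null.\<close>

lemma quotient_measure_open_pos:
  fixes \<Gamma> :: "'g::{topological_group_add,t2_space} set"
  assumes G: "add_subgroup \<Gamma>" and \<mu>: "radon_measure (coset_topology \<Gamma>) \<mu>"
    and nz: "emeasure \<mu> (space \<mu>) \<noteq> 0"
    and inv: "\<And>g A. A \<in> sets \<mu> \<Longrightarrow> emeasure \<mu> ((\<lambda>C. (+) g ` C) ` A) = emeasure \<mu> A"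
    and W: "open W" "0 \<in> W"
  shows "emeasure \<mu> (left_coset \<Gamma> ` W) \<noteq> 0"
proof
  assume 0: "emeasure \<mu> (left_coset \<Gamma> ` W) = 0"
  let ?T = "coset_topology \<Gamma>"
  have sets: "left_coset \<Gamma> ` U \<in> sets \<mu>" if "open U" for U
    by (rule radon_measure_openin_sets[OF \<mu> openin_coset_image[OF G that]])
  have sp: "space \<mu> = topspace ?T" by (rule radon_measureD(1)[OF \<mu>])
  have top: "topspace ?T = range (left_coset \<Gamma>)"
    using quotient_imp_surjective_map[OF quotient_map_left_coset[of \<Gamma>]] by simp
  have null: "emeasure \<mu> C = 0" if C: "compactin ?T C" for C
  proof -
    have in_cov: "left_coset \<Gamma> x \<in> left_coset \<Gamma> ` left_coset W x" for x
      using W(2) by (intro imageI) (simp add: mem_left_coset)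
    have cov: "C \<subseteq> \<Union>(range (\<lambda>x. left_coset \<Gamma> ` left_coset W x))"
    proof (intro subsetI)
      fix q assume "q \<in> C"
      then obtain x where "q = left_coset \<Gamma> x"
        using compactin_subset_topspace[OF C] unfolding top by auto
      then show "q \<in> \<Union>(range (\<lambda>x. left_coset \<Gamma> ` left_coset W x))"
        using in_cov[of x] by auto
    qed
    have "\<And>B. B \<in> range (\<lambda>x. left_coset \<Gamma> ` left_coset W x) \<Longrightarrow> openin ?T B"
      using openin_coset_image[OF G open_left_coset[OF W(1)]] by auto
    from compactinD[OF C this cov]
    obtain F where F: "finite F" "F \<subseteq> range (\<lambda>x. left_coset \<Gamma> ` left_coset W x)" "C \<subseteq> \<Union>F"
      by blast
    have "B \<in> null_sets \<mu>" if "B \<in> F" for B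
    proof -
      obtain x where x: "B = left_coset \<Gamma> ` left_coset W x" using F(2) \<open>B \<in> F\<close> by blast
      have "emeasure \<mu> B = 0"
        using inv[OF sets[OF W(1)], of x] 0 x
        by (simp add: translate_coset_image) (simp add: left_coset_def)
      then show ?thesis using x sets[OF open_left_coset[OF W(1)]] by auto
    qed
    then have "\<Union>F \<in> null_sets \<mu>"
      using null_sets_UN'[of F "\<lambda>x. x"] countable_finite[OF F(1)] by simp
    then show ?thesis
      using emeasure_mono[OF F(3), of \<mu>] by (simp add: null_sets_def)
  qed
  have "emeasure \<mu> (space \<mu>) = (SUP C\<in>{C. compactin ?T C \<and> C \<subseteq> topspace ?T}. emeasure \<mu> C)"
    unfolding sp by (rule radon_measureD(5)[OF \<mu> openin_topspace])
  also have "\<dots> \<le> 0"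
    using null by (intro SUP_least) simp
  finally have "emeasure \<mu> (space \<mu>) \<le> 0" .
  then show False using nz by simp
qed

text \<open>The point where the finite invariant measure on the coset space enters: it shows that \<open>V\<close> and its conjugate contain their
  intersection with the same index.\<close>

lemma haar_measure_lattice_conjugate:
  fixes m :: "'g::{topological_group_add,t2_space} measure"
  assumes m: "left_haar_measure m" and lat: "lattice_subgroup \<Gamma>" and c: "c \<in> \<Gamma>"
    and V: "compact_open_subgroup V" "V \<inter> \<Gamma> = {0}"
  shows "emeasure m ((\<lambda>x. - c + x + c) ` V) = emeasure m V"
proof -
  obtain \<mu> where G: "add_subgroup \<Gamma>" and \<mu>: "radon_measure (coset_topology \<Gamma>) \<mu>"
    and nz: "emeasure \<mu> (space \<mu>) \<noteq> 0" and fin: "emeasure \<mu> (space \<mu>) < \<infinity>"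
    and inv: "\<And>g A. A \<in> sets \<mu> \<Longrightarrow> emeasure \<mu> ((\<lambda>C. (+) g ` C) ` A) = emeasure \<mu> A"
    using lat unfolding lattice_subgroup_def by blast
  define V' where "V' = (\<lambda>x. - c + x + c) ` V"
  define W where "W = V \<inter> V'"
  have V': "compact_open_subgroup V'"
    unfolding V'_def by (rule compact_open_subgroup_conjugate[OF V(1)])
  have W: "compact_open_subgroup W"
    unfolding W_def by (rule compact_open_subgroup_Int[OF V(1) V'])
  \<comment> \<open>Conjugation by an element of \<open>\<Gamma>\<close> preserves \<open>\<Gamma>\<close>.\<close>
  have V'G: "V' \<inter> \<Gamma> = {0}"
  proof -
    have "x = 0" if "x \<in> V" "- c + x + c \<in> \<Gamma>" for x
    proof -
      have "c + (- c + x + c) + - c \<in> \<Gamma>"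
        using add_subgroupD(2,3)[OF G] c that(2) by blast
      then have "x \<in> \<Gamma>" by (simp only: add.assoc minus_add_cancel add_minus_cancel right_minus add_0_right)
      then show ?thesis using V(2) that(1) by blast
    qed
    moreover have "0 \<in> V'" using V' add_subgroupD(1) by (auto simp: compact_open_subgroup_def)
    ultimately show ?thesis
      using add_subgroupD(1)[OF G] unfolding V'_def by fastforce
  qed
  have oV: "open V" "open W" and W0: "0 \<in> W"
    using V W add_subgroupD(1) by (auto simp: compact_open_subgroup_def)
  have sets: "left_coset \<Gamma> ` U \<in> sets \<mu>" if "open U" for U
    by (rule radon_measure_openin_sets[OF \<mu> openin_coset_image[OF G that]])
  \<comment> \<open>The trailing \<open>c\<close> is absorbed by \<open>\<Gamma>\<close>, so only the left translation by \<open>- c\<close> survives in the quotient.\<close>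
  have "left_coset \<Gamma> ` V' = (\<lambda>C. (+) (- c) ` C) ` left_coset \<Gamma> ` V"
  proof -
    have "left_coset \<Gamma> (- c + x + c) = left_coset \<Gamma> (- c + x)" for x
    proof -
      have "- (- c + x + c) + (- c + x) = - c"
        by (simp only: minus_add add.assoc minus_minus minus_add_cancel add_minus_cancel left_minus add_0_right)
      then show ?thesis using add_subgroupD(3)[OF G c] by (simp only: left_coset_eq_iff[OF G])
    qed
    then show ?thesis by (simp only: V'_def image_image translate_left_coset)
  qed
  then have "emeasure \<mu> (left_coset \<Gamma> ` V') = emeasure \<mu> (left_coset \<Gamma> ` V)"
    using inv[OF sets[OF oV(1)]] by simp
  then have "of_nat (coset_index V' W) * emeasure \<mu> (left_coset \<Gamma> ` W)
      = of_nat (coset_index V W) * emeasure \<mu> (left_coset \<Gamma> ` W)"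
    using quotient_measure_index[OF G \<mu> inv V W] quotient_measure_index[OF G \<mu> inv V' V'G W]
    by (simp add: W_def)
  moreover have "emeasure \<mu> (left_coset \<Gamma> ` W) \<noteq> 0"
    using quotient_measure_open_pos[OF G \<mu> nz inv oV(2) W0] .
  moreover have "emeasure \<mu> (left_coset \<Gamma> ` W) \<noteq> \<infinity>"
    using emeasure_space[of \<mu> "left_coset \<Gamma> ` W"] fin by auto
  \<comment> \<open>The common factor can be cancelled only because it is neither zero nor infinite.\<close>
  ultimately have "coset_index V' W = coset_index V W"
    by (simp add: mult.commute[of "of_nat _"] ennreal_mult_cancel_left)
  then show ?thesis
    using haar_measure_index[OF m V(1) W] haar_measure_index[OF m V' W]
    by (simp add: W_def V'_def)
qed

text \<open>A right translate of a coset of \<open>V\<close> is a left coset of the conjugate of \<open>V\<close>.\<close>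

lemma haar_measure_right_translate_coset:
  fixes m :: "'g::{topological_group_add,t2_space} measure"
  assumes m: "left_haar_measure m" and lat: "lattice_subgroup \<Gamma>" and c: "c \<in> \<Gamma>"
    and V: "compact_open_subgroup V" "V \<inter> \<Gamma> = {0}"
  shows "emeasure m ((\<lambda>x. x + c) ` left_coset V g) = emeasure m V"
proof -
  let ?V' = "(\<lambda>x. - c + x + c) ` V"
  have "(\<lambda>x. x + c) ` left_coset V g = left_coset ?V' (g + c)"
    by (simp only: left_coset_def image_image add.assoc add_minus_cancel)
  moreover have "open ?V'"
    using compact_open_subgroup_conjugate[OF V(1)] by (auto simp: compact_open_subgroup_def)
  then have "emeasure m (left_coset ?V' (g + c)) = emeasure m ?V'"
    by (intro left_haarD[OF m]) simp
  ultimately show ?thesis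
    using haar_measure_lattice_conjugate[OF m lat c V] by simp
qed

text \<open>By inner regularity it suffices to bound the measure of a compact subset \<open>C\<close>. Thickened by a small enough \<open>V\<close>, it
  becomes a finite disjoint union of cosets of \<open>V\<close> inside \<open>U\<close>, whose measure does not change under right translation.\<close>

lemma haar_measure_right_translate_open_le:
  fixes m :: "'g::{topological_group_add,t2_space} measure"
  assumes lc: "locally_compact_space (euclidean :: 'g topology)"
    and td: "totally_disconnected (UNIV :: 'g set)"
    and m: "left_haar_measure m" and lat: "lattice_subgroup \<Gamma>" and c: "c \<in> \<Gamma>"
    and U: "open U"
  shows "emeasure m U \<le> emeasure m ((\<lambda>x. x + c) ` U)"
proof -
  have G: "add_subgroup \<Gamma>" using lat by (simp add: lattice_subgroup_def)
  \<comment> \<open>Discreteness makes every small enough subgroup meet \<open>\<Gamma>\<close> only in \<open>0\<close>.\<close>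
  obtain D where D: "open D" "D \<inter> \<Gamma> = {0}"
    using lat add_subgroupD(1)[OF G]
    by (auto simp: lattice_subgroup_def discrete_def isolated_in_def)
  have "emeasure m C \<le> emeasure m ((\<lambda>x. x + c) ` U)" if C: "compact C" "C \<subseteq> U" for C
  proof -
    obtain N where N: "open N" "0 \<in> N" "\<And>x n. x \<in> C \<Longrightarrow> n \<in> N \<Longrightarrow> x + n \<in> U"
      using compact_plus_neighbourhood[OF C(1) U C(2)] by blast
    have "open (N \<inter> D)" "0 \<in> N \<inter> D" using N D by (auto simp: open_Int)
    then obtain V where V: "compact_open_subgroup V" "V \<subseteq> N \<inter> D"
      using van_Dantzig[OF lc td] by blast
    have Vs: "add_subgroup V" "open V" using V by (auto simp: compact_open_subgroup_def)
    have VG: "V \<inter> \<Gamma> = {0}"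
      using V(2) D(2) add_subgroupD(1)[OF G] add_subgroupD(1)[OF Vs(1)] by blast
    define CV where "CV = (\<Union>x\<in>C. left_coset V x)"
    have oCV: "open CV" unfolding CV_def using open_left_coset[OF Vs(2)] by blast
    have "CV \<subseteq> U" using N(3) V(2) by (auto simp: CV_def left_coset_def)
    have "C \<subseteq> CV" using self_in_left_coset[OF Vs(1)] by (auto simp: CV_def)
    then have "emeasure m C \<le> emeasure m CV"
      using oCV left_haarD(1)[OF m] by (intro emeasure_mono) auto
    also have "emeasure m CV = of_nat (card (left_coset V ` C)) * emeasure m V"
      using emeasure_UN_left_cosets[OF Vs C(1), of "\<lambda>x. x" m "emeasure m V"]
        left_haarD(1,4)[OF m] open_left_coset[OF Vs(2)] Vs(2)
      by (simp add: CV_def)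
    also have "\<dots> = emeasure m ((\<lambda>x. x + c) ` CV)"
      unfolding CV_def
    proof (rule emeasure_UN_left_cosets[symmetric, OF Vs C(1)])
      show "emeasure m ((\<lambda>x. x + c) ` left_coset V x) = emeasure m V" for x
        by (rule haar_measure_right_translate_coset[OF m lat c V(1) VG])
      show "(\<lambda>x. x + c) ` left_coset V x \<in> sets m" for x
        using open_right_translate[OF open_left_coset[OF Vs(2)]] left_haarD(1)[OF m] by simp
    qed (simp add: inj_on_def)
    also have "\<dots> \<le> emeasure m ((\<lambda>x. x + c) ` U)"
      using \<open>CV \<subseteq> U\<close> left_haarD(1)[OF m] open_right_translate[OF U]
      by (intro emeasure_mono) auto
    finally show ?thesis .
  qed
  then show ?thesis
    unfolding left_haarD(6)[OF m U] by (intro SUP_least) auto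
qed

text \<open>Outer regularity extends the inequality for open sets to Borel sets. Translating back by \<open>- c\<close> gives the converse
  inequality.\<close>

theorem haar_measure_right_invariant_lattice:
  fixes m :: "'g::{topological_group_add,t2_space} measure"
  assumes lc: "locally_compact_space (euclidean :: 'g topology)"
    and td: "totally_disconnected (UNIV :: 'g set)"
    and m: "left_haar_measure m" and lat: "lattice_subgroup \<Gamma>" and c: "c \<in> \<Gamma>"
    and A: "A \<in> sets borel"
  shows "emeasure m ((\<lambda>x. x + c) ` A) = emeasure m A"
proof -
  have le: "emeasure m A \<le> emeasure m ((\<lambda>x. x + c) ` A)" if A: "A \<in> sets borel" and c: "c \<in> \<Gamma>" for A c
    unfolding left_haarD(5)[OF m borel_right_translate[OF A]]
  proof (rule INF_greatest)
    fix U assume U: "U \<in> {U. open U \<and> (\<lambda>x. x + c) ` A \<subseteq> U}"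
    let ?U = "(\<lambda>x. x + - c) ` U"
    have oU: "open ?U" using open_right_translate[of U "- c"] U by simp
    have translate_back: "(\<lambda>x. x + c) ` ?U = U" by (simp add: image_image)
    have "A \<subseteq> ?U" using U by (force simp: image_iff subset_eq)
    then have "emeasure m A \<le> emeasure m ?U"
      using left_haarD(1)[OF m] oU by (intro emeasure_mono) auto
    also have "\<dots> \<le> emeasure m ((\<lambda>x. x + c) ` ?U)"
      by (rule haar_measure_right_translate_open_le[OF lc td m lat c oU])
    finally show "emeasure m A \<le> emeasure m U" unfolding translate_back .
  qed
  have G: "add_subgroup \<Gamma>" using lat by (simp add: lattice_subgroup_def)
  have "emeasure m ((\<lambda>x. x + c) ` A) \<le> emeasure m ((\<lambda>x. x + - c) ` (\<lambda>x. x + c) ` A)"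
    by (rule le[OF borel_right_translate[OF A] add_subgroupD(3)[OF G c]])
  also have "(\<lambda>x. x + - c) ` (\<lambda>x. x + c) ` A = A" by (simp add: image_image)
  finally show ?thesis using le[OF A c] by (rule antisym)
qed

section \<open>Word length\<close>

text \<open>The spheres of the word metric are awkward, since whether a word is shortest is a global condition. These sets are
  compact when \<open>S\<close> is, and word length is the first \<open>n\<close> at which they contain the given element.\<close>

definition words_of_length :: "'g::group_add set \<Rightarrow> nat \<Rightarrow> 'g set" where
  "words_of_length S n = {g. \<exists>xs. length xs = n \<and> set xs \<subseteq> S \<union> uminus ` S \<and> sum_list xs = g}"

lemma word_length_words: "word_length S g = (LEAST n. g \<in> words_of_length S n)"
  by (simp add: word_length_def words_of_length_def)

lemma words_of_length_add:
  assumes "a \<in> words_of_length S k" "b \<in> words_of_length S l"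
  shows "a + b \<in> words_of_length S (k + l)"
proof -
  obtain xs ys where *: "length xs = k" "set xs \<subseteq> S \<union> uminus ` S" "sum_list xs = a"
    "length ys = l" "set ys \<subseteq> S \<union> uminus ` S" "sum_list ys = b"
    using assms unfolding words_of_length_def by blast
  then show ?thesis
    unfolding words_of_length_def by (intro CollectI exI[of _ "xs @ ys"]) auto
qed

lemma words_of_length_uminus:
  assumes "a \<in> words_of_length S k"
  shows "- a \<in> words_of_length S k"
proof -
  obtain xs where xs: "length xs = k" "set xs \<subseteq> S \<union> uminus ` S" "sum_list xs = a"
    using assms unfolding words_of_length_def by blast
  have "sum_list (rev (map uminus xs)) = - sum_list xs" for xs :: "'a list"
    by (induction xs) (simp_all add: minus_add)
  moreover have "set (rev (map uminus xs)) \<subseteq> S \<union> uminus ` S"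
    using xs(2) by force
  ultimately show ?thesis
    unfolding words_of_length_def using xs
    by (intro CollectI exI[of _ "rev (map uminus xs)"]) auto
qed

lemma words_of_length_0: "words_of_length S 0 = {0}"
  by (auto simp: words_of_length_def)

lemma words_of_length_Suc:
  "words_of_length S (Suc n) = (\<lambda>(a, b). a + b) ` ((S \<union> uminus ` S) \<times> words_of_length S n)"
proof (intro equalityI subsetI)
  fix g assume "g \<in> words_of_length S (Suc n)"
  then obtain ys where ys: "length ys = Suc n" "set ys \<subseteq> S \<union> uminus ` S" "sum_list ys = g"
    unfolding words_of_length_def by blast
  then obtain x xs where "ys = x # xs" by (cases ys) auto
  then have "length xs = n" "x \<in> S \<union> uminus ` S" "set xs \<subseteq> S \<union> uminus ` S" "g = x + sum_list xs"
    using ys by simp_all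
  then show "g \<in> (\<lambda>(a, b). a + b) ` ((S \<union> uminus ` S) \<times> words_of_length S n)"
    by (intro image_eqI[of _ _ "(x, sum_list xs)"]) (auto simp: words_of_length_def)
next
  fix g assume "g \<in> (\<lambda>(a, b). a + b) ` ((S \<union> uminus ` S) \<times> words_of_length S n)"
  then obtain x b where "x \<in> S \<union> uminus ` S" "b \<in> words_of_length S n" "g = x + b"
    by auto
  then obtain xs where *: "length xs = n" "x \<in> S \<union> uminus ` S" "set xs \<subseteq> S \<union> uminus ` S" "g = x + sum_list xs"
    unfolding words_of_length_def by blast
  show "g \<in> words_of_length S (Suc n)"
    unfolding words_of_length_def using * by (intro CollectI exI[of _ "x # xs"]) simp
qed

text \<open>The elements that are represented by words form a subgroup that contains \<open>S\<close>, hence all of \<open>H\<close>.\<close>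

lemma ex_words_of_length:
  assumes "generates S H" "g \<in> H"
  shows "\<exists>n. g \<in> words_of_length S n"
proof -
  let ?P = "{g. \<exists>n. g \<in> words_of_length S n}"
  have "add_subgroup ?P"
    unfolding add_subgroup_def
    using words_of_length_0[of S] words_of_length_add[of _ S] words_of_length_uminus[of _ S]
    by blast
  moreover have "S \<subseteq> ?P"
  proof
    fix x assume "x \<in> S"
    then have "x \<in> words_of_length S 1"
      unfolding words_of_length_def by (intro CollectI exI[of _ "[x]"]) simp
    then show "x \<in> ?P" by blast
  qed
  ultimately have "add_subgroup hull S \<subseteq> ?P" by (intro hull_minimal)
  then show ?thesis using assms by (auto simp: generates_def)
qed

lemma in_words_of_word_length:
  assumes "generates S H" "g \<in> H"
  shows "g \<in> words_of_length S (word_length S g)"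
  unfolding word_length_words using ex_words_of_length[OF assms] by (rule LeastI_ex)

lemma word_length_le: "g \<in> words_of_length S n \<Longrightarrow> word_length S g \<le> n"
  unfolding word_length_words by (rule Least_le)

lemma word_length_add:
  assumes "generates S H" "a \<in> H" "b \<in> H"
  shows "word_length S (a + b) \<le> word_length S a + word_length S b"
  by (intro word_length_le words_of_length_add in_words_of_word_length[OF assms(1)] assms)

lemma word_length_uminus:
  assumes "generates S H" "a \<in> H"
  shows "word_length S (- a) \<le> word_length S a"
  by (intro word_length_le words_of_length_uminus in_words_of_word_length[OF assms])

lemma word_length_eq_0D:
  assumes "generates S H" "a \<in> H" "word_length S a = 0"
  shows "a = 0"
  using in_words_of_word_length[OF assms(1,2)] assms(3) by (simp add: words_of_length_0)

lemma countable_finitely_generated: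
  assumes "finite S" "generates S H"
  shows "countable H"
proof -
  have "finite (words_of_length S n)" for n
    by (induction n) (use assms(1) in \<open>simp_all add: words_of_length_0 words_of_length_Suc\<close>)
  then have "countable (\<Union>n. words_of_length S n)"
    by (intro countable_UN) (auto intro: countable_finite)
  moreover have "H \<subseteq> (\<Union>n. words_of_length S n)"
    using ex_words_of_length[OF assms(2)] by blast
  ultimately show ?thesis by (rule countable_subset[rotated])
qed

lemma compact_words_of_length:
  fixes K :: "'g::topological_group_add set"
  assumes "compact K"
  shows "compact (words_of_length K n)"
proof (induction n)
  case (Suc n)
  have "compact (uminus ` K)"
    by (rule compact_continuous_image[OF _ assms]) (intro continuous_intros)
  then have "compact ((K \<union> uminus ` K) \<times> words_of_length K n)"
    using assms Suc by (intro compact_Times compact_Un)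
  then show ?case
    unfolding words_of_length_Suc case_prod_beta
    by (intro compact_continuous_image[rotated] continuous_intros)
qed (simp add: words_of_length_0)

lemma measurable_word_length:
  fixes K :: "'g::{topological_group_add,t2_space} set"
  assumes "compact K"
  shows "word_length K \<in> measurable borel (count_space UNIV)"
proof -
  have "words_of_length K n \<in> sets borel" for n
    using compact_words_of_length[OF assms] by (intro borel_closed compact_imp_closed)
  then have "(\<lambda>g. LEAST n. g \<in> words_of_length K n) \<in> measurable borel (count_space UNIV)"
    by (intro measurable_Least) (simp add: pred_def)
  then show ?thesis by (simp add: word_length_words[abs_def])
qed

section \<open>Fundamental domains and the induced action\<close>

text \<open>The first form is the existence and uniqueness behind the induction cocycle; the second says directly that the
  translates of \<open>\<Omega>\<close> partition the group.\<close>

lemma fundamental_domain_unique: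
  assumes G: "add_subgroup \<Gamma>" and \<Omega>: "borel_fundamental_domain \<Gamma> \<Omega>"
  shows "\<exists>!c. c \<in> \<Gamma> \<and> y + c \<in> \<Omega>" and "\<exists>!c. c \<in> \<Gamma> \<and> y + - c \<in> \<Omega>"
proof -
  have mem: "y \<in> (\<lambda>x. x + c) ` \<Omega> \<longleftrightarrow> y + - c \<in> \<Omega>" for c
    unfolding right_translate_vimage by simp
  have "y \<in> (\<Union>c\<in>\<Gamma>. (\<lambda>x. x + c) ` \<Omega>)"
    using \<Omega> by (auto simp: borel_fundamental_domain_def)
  then obtain c where c: "c \<in> \<Gamma>" "y + - c \<in> \<Omega>"
    using mem by blast
  have uniq: "d = c" if "d \<in> \<Gamma>" "y + - d \<in> \<Omega>" for d
    using that c \<Omega> mem unfolding borel_fundamental_domain_def disjoint_family_on_def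
    by (metis (no_types, lifting) disjoint_iff)
  show "\<exists>!c. c \<in> \<Gamma> \<and> y + - c \<in> \<Omega>"
    using c uniq by blast
  show "\<exists>!c. c \<in> \<Gamma> \<and> y + c \<in> \<Omega>"
  proof (intro ex1I conjI)
    show "- c \<in> \<Gamma>" "y + - c \<in> \<Omega>" using c add_subgroupD(3)[OF G] by auto
    fix d assume "d \<in> \<Gamma> \<and> y + d \<in> \<Omega>"
    then have "- d = c" using uniq[of "- d"] add_subgroupD(3)[OF G, of d]
      by (simp only: minus_minus)
    then show "d = - c" by auto
  qed
qed

lemma induction_cocycle_mem:
  assumes "add_subgroup \<Gamma>" "borel_fundamental_domain \<Gamma> \<Omega>"
  shows "induction_cocycle \<Gamma> \<Omega> g h \<in> \<Gamma>" "g + h + induction_cocycle \<Gamma> \<Omega> g h \<in> \<Omega>"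
  using theI'[OF fundamental_domain_unique(1)[OF assms, of "g + h"]]
  by (auto simp: induction_cocycle_def)

lemma induction_cocycle_eqI:
  assumes "add_subgroup \<Gamma>" "borel_fundamental_domain \<Gamma> \<Omega>" "c \<in> \<Gamma>" "g + h + c \<in> \<Omega>"
  shows "induction_cocycle \<Gamma> \<Omega> g h = c"
  using fundamental_domain_unique(1)[OF assms(1,2), of "g + h"] induction_cocycle_mem[OF assms(1,2)] assms(3,4)
  by blast

text \<open>Integration over the counting measure of \<open>\<Gamma>\<close> serves as a sum over \<open>\<Gamma>\<close> that can be exchanged with the Haar
  integral; here the sum has at most one nonzero term.\<close>

lemma nn_integral_count_space_unique:
  assumes "c \<in> I" "\<And>i. i \<in> I \<Longrightarrow> i \<noteq> c \<Longrightarrow> f i = (0::ennreal)"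
  shows "(\<integral>\<^sup>+i. f i \<partial>count_space I) = f c"
  using assms by (subst nn_integral_count_space'[of "{c}"]) auto

lemma measurable_translate:
  "(\<lambda>x. g + x + c) \<in> measurable borel (borel :: 'g::topological_group_add measure)"
  by (intro borel_measurable_continuous_onI continuous_intros)

text \<open>The cocycle takes countably many values, and each of its fibres is a translate of \<open>\<Omega>\<close>.\<close>

lemma measurable_induction_cocycle:
  assumes G: "add_subgroup \<Gamma>" "countable \<Gamma>" and \<Omega>: "borel_fundamental_domain \<Gamma> \<Omega>"
  shows "induction_cocycle \<Gamma> \<Omega> g \<in> measurable borel (count_space \<Gamma>)"
  unfolding measurable_count_space_eq_countable[OF G(2)]
proof (intro conjI ballI)
  fix c assume c: "c \<in> \<Gamma>"
  have "induction_cocycle \<Gamma> \<Omega> g -` {c} = (\<lambda>h. g + h + c) -` \<Omega>"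
  proof (intro set_eqI iffI; unfold vimage_def mem_Collect_eq)
    fix h assume "g + h + c \<in> \<Omega>"
    then show "induction_cocycle \<Gamma> \<Omega> g h \<in> {c}"
      using induction_cocycle_eqI[OF G(1) \<Omega> c] by simp
  next
    fix h assume "induction_cocycle \<Gamma> \<Omega> g h \<in> {c}"
    then show "g + h + c \<in> \<Omega>"
      using induction_cocycle_mem(2)[OF G(1) \<Omega>, of g h] by simp
  qed
  then show "induction_cocycle \<Gamma> \<Omega> g -` {c} \<inter> space borel \<in> sets borel"
    using measurable_sets[OF measurable_translate, of \<Omega> g c] \<Omega>
    by (simp add: borel_fundamental_domain_def)
qed (use induction_cocycle_mem[OF G(1) \<Omega>] in auto)

text \<open>The translation to the left is harmless for a left Haar measure; the one to the right uses that \<open>c\<close> lies in the lattice.\<close>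

lemma nn_integral_translate:
  fixes m :: "'g::{topological_group_add,t2_space} measure"
  assumes lc: "locally_compact_space (euclidean :: 'g topology)"
    and td: "totally_disconnected (UNIV :: 'g set)"
    and m: "left_haar_measure m" and lat: "lattice_subgroup \<Gamma>" and c: "c \<in> \<Gamma>"
    and f: "f \<in> borel_measurable borel"
  shows "(\<integral>\<^sup>+x. f (g + x + c) \<partial>m) = (\<integral>\<^sup>+x. f x \<partial>m)"
proof -
  have sm: "sets m = sets borel" and sp: "space m = UNIV" using left_haarD[OF m] by auto
  have T: "(\<lambda>x. g + x + c) \<in> measurable m borel"
    using measurable_translate[of g c] by (simp add: measurable_cong_sets[OF sm refl])
  have "- c \<in> \<Gamma>"
    using lat c add_subgroupD(3) by (auto simp: lattice_subgroup_def)
  have "distr m borel (\<lambda>x. g + x + c) = m"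
  proof (rule measure_eqI)
    fix A assume "A \<in> sets (distr m borel (\<lambda>x. g + x + c))"
    then have A: "A \<in> sets borel" by simp
    have "(\<lambda>x. g + x + c) -` A = left_coset ((\<lambda>x. x + - c) ` A) (- g)"
      unfolding left_coset_vimage right_translate_vimage by (auto simp only: vimage_def minus_minus)
    then have "emeasure m ((\<lambda>x. g + x + c) -` A) = emeasure m A"
      using left_haarD(4)[OF m borel_right_translate[OF A]]
        haar_measure_right_invariant_lattice[OF lc td m lat \<open>- c \<in> \<Gamma>\<close> A] by (simp only:)
    then show "emeasure (distr m borel (\<lambda>x. g + x + c)) A = emeasure m A"
      using emeasure_distr[OF T A] by (simp add: sp)
  qed (simp add: sm)
  moreover have "f \<in> borel_measurable (distr m borel (\<lambda>x. g + x + c))"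
    using f by simp
  ultimately show ?thesis
    using nn_integral_distr[OF T, of f] by simp
qed

text \<open>The action of \<open>g\<close> on \<open>\<Omega>\<close>, seen as the coset space, preserves the Haar measure. The proof splits \<open>\<Omega>\<close> by the
  value \<open>c\<close> of the cocycle, translates each piece by \<open>g\<close> and \<open>c\<close>, and sums again. The translated pieces tile \<open>\<Omega>\<close>
  because the image of \<open>\<Omega>\<close> under \<open>g\<close> is again a fundamental domain.\<close>

lemma nn_integral_induced_action:
  fixes m :: "'g::{topological_group_add,t2_space} measure"
  assumes lc: "locally_compact_space (euclidean :: 'g topology)"
    and td: "totally_disconnected (UNIV :: 'g set)"
    and m: "left_haar_measure m" and lat: "lattice_subgroup \<Gamma>" and cnt: "countable \<Gamma>"
    and \<Omega>: "borel_fundamental_domain \<Gamma> \<Omega>"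
    and f: "f \<in> borel_measurable borel"
  shows "(\<integral>\<^sup>+h\<in>\<Omega>. f (g + h + induction_cocycle \<Gamma> \<Omega> g h) \<partial>m) = (\<integral>\<^sup>+h\<in>\<Omega>. f h \<partial>m)"
proof -
  have G: "add_subgroup \<Gamma>" using lat by (simp add: lattice_subgroup_def)
  have sm: "sets m = sets borel" using left_haarD[OF m] by auto
  have \<Omega>_sets: "\<Omega> \<in> sets borel" using \<Omega> by (simp add: borel_fundamental_domain_def)
  \<comment> \<open>The contribution of \<open>c\<close>, written in terms of the image point \<open>x = g + h + c\<close> rather than of \<open>h\<close>.\<close>
  define F where "F c x = indicator \<Omega> (- g + x + - c) * (f x * indicator \<Omega> x)" for c x
  have F: "F c \<in> borel_measurable borel" for c
  proof -
    have "(\<lambda>x. indicator \<Omega> (- g + x + - c) :: ennreal) \<in> borel_measurable borel"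
      using measurable_compose[OF measurable_translate borel_measurable_indicator[OF \<Omega>_sets]] .
    then show ?thesis unfolding F_def using f \<Omega>_sets by measurable
  qed
  have FT: "F c (g + h + c) = indicator \<Omega> h * (f (g + h + c) * indicator \<Omega> (g + h + c))" for c h
  proof -
    have "- g + (g + h + c) + - c = h"
      by (simp only: add.assoc minus_add_cancel right_minus add_0_right)
    then show ?thesis by (simp only: F_def)
  qed
  have "(\<integral>\<^sup>+h\<in>\<Omega>. f (g + h + induction_cocycle \<Gamma> \<Omega> g h) \<partial>m)
      = (\<integral>\<^sup>+h. (\<integral>\<^sup>+c. F c (g + h + c) \<partial>count_space \<Gamma>) \<partial>m)"
  proof (rule nn_integral_cong)
    fix h
    let ?c = "induction_cocycle \<Gamma> \<Omega> g h"
    have "(\<integral>\<^sup>+c. F c (g + h + c) \<partial>count_space \<Gamma>) = F ?c (g + h + ?c)"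
    proof (rule nn_integral_count_space_unique)
      fix c assume c: "c \<in> \<Gamma>" "c \<noteq> ?c"
      then have "g + h + c \<notin> \<Omega>" using induction_cocycle_eqI[OF G \<Omega>] by blast
      then show "F c (g + h + c) = 0" by (simp add: FT)
    qed (rule induction_cocycle_mem[OF G \<Omega>])
    then show "f (g + h + ?c) * indicator \<Omega> h = (\<integral>\<^sup>+c. F c (g + h + c) \<partial>count_space \<Gamma>)"
      using induction_cocycle_mem(2)[OF G \<Omega>, of g h] by (simp add: FT mult.commute)
  qed
  also have "\<dots> = (\<integral>\<^sup>+c. (\<integral>\<^sup>+h. F c (g + h + c) \<partial>m) \<partial>count_space \<Gamma>)"
    using measurable_compose[OF measurable_translate F]
    by (intro nn_integral_count_space_nn_integral cnt) (simp add: measurable_cong_sets[OF sm refl])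
  also have "\<dots> = (\<integral>\<^sup>+c. (\<integral>\<^sup>+x. F c x \<partial>m) \<partial>count_space \<Gamma>)"
    by (intro nn_integral_cong nn_integral_translate[OF lc td m lat _ F]) simp
  also have "\<dots> = (\<integral>\<^sup>+x. (\<integral>\<^sup>+c. F c x \<partial>count_space \<Gamma>) \<partial>m)"
    using F by (intro nn_integral_count_space_nn_integral[symmetric] cnt)
      (simp add: measurable_cong_sets[OF sm refl])
  also have "\<dots> = (\<integral>\<^sup>+h\<in>\<Omega>. f h \<partial>m)"
  proof (rule nn_integral_cong)
    fix x
    obtain c where c: "c \<in> \<Gamma>" "- g + x + - c \<in> \<Omega>" "\<And>d. d \<in> \<Gamma> \<Longrightarrow> - g + x + - d \<in> \<Omega> \<Longrightarrow> d = c"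
      using fundamental_domain_unique(2)[OF G \<Omega>, of "- g + x"] by blast
    have "(\<integral>\<^sup>+c. F c x \<partial>count_space \<Gamma>) = F c x"
    proof (rule nn_integral_count_space_unique[OF c(1)])
      fix d assume "d \<in> \<Gamma>" "d \<noteq> c"
      then have "- g + x + - d \<notin> \<Omega>" using c(3) by blast
      then show "F d x = 0" by (simp add: F_def indicator_def del: add_uminus_conv_diff)
    qed
    also have "\<dots> = f x * indicator \<Omega> x"
      using c(2) by (simp add: F_def indicator_def del: add_uminus_conv_diff)
    finally show "(\<integral>\<^sup>+c. F c x \<partial>count_space \<Gamma>) = f x * indicator \<Omega> x" .
  qed
  finally show ?thesis .
qed

section \<open>Integrability of the induction cocycle\<close>

lemma powr_add3_le:
  fixes a b c p :: real
  assumes "0 \<le> a" "0 \<le> b" "0 \<le> c" "0 \<le> p"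
  shows "(a + b + c) powr p \<le> 3 powr p * (a powr p + b powr p + c powr p)"
proof -
  define M where "M = max a (max b c)"
  have "(a + b + c) powr p \<le> (3 * M) powr p"
    using assms by (intro powr_mono2) (auto simp: M_def)
  also have "\<dots> = 3 powr p * M powr p"
    by (rule powr_mult)
  also have "M powr p \<le> a powr p + b powr p + c powr p"
    by (auto simp: M_def max_def)
  finally show ?thesis by simp
qed

text \<open>The lower bound of the quasi-isometric embedding, applied to the pair \<open>(0, c)\<close>.\<close>

lemma undistorted_word_length_le:
  assumes "undistorted \<Gamma> S K" "0 \<in> \<Gamma>"
  obtains L C where "1 \<le> L" "0 \<le> C"
    "\<And>c. c \<in> \<Gamma> \<Longrightarrow> real (word_length S c) \<le> L * (real (word_length K c) + C)"
proof -
  obtain L C where LC: "1 \<le> L" "0 \<le> C"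
    and qi: "\<And>x y. x \<in> \<Gamma> \<Longrightarrow> y \<in> \<Gamma> \<Longrightarrow> word_dist S x y / L - C \<le> word_dist K x y"
    using assms(1) unfolding undistorted_def quasi_isometric_embedding_def by blast
  have "real (word_length S c) \<le> L * (real (word_length K c) + C)" if "c \<in> \<Gamma>" for c
    using qi[OF assms(2) that] LC(1) by (simp add: word_dist_def field_simps)
  then show ?thesis using that LC by blast
qed

theorem theorem1p3:
  fixes m :: "'g :: {topological_group_add, t2_space} measure"
    and \<Gamma> S K \<Omega> :: "'g set"
    and p :: real
  assumes "locally_compact_space (euclidean :: 'g topology)"
    and "totally_disconnected (UNIV :: 'g set)"
    and "left_haar_measure m"
    and "lattice_subgroup \<Gamma>"
    and "compact K" and "generates K UNIV"
    and "finite S" and "generates S \<Gamma>"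
    and "1 \<le> p"
    and "borel_fundamental_domain \<Gamma> \<Omega>"
    and "(\<integral>\<^sup>+h\<in>\<Omega>. ennreal (real (word_length K h) powr p) \<partial>m) < \<infinity>"
    and "undistorted \<Gamma> S K"
  shows "p_integrable m \<Gamma> S p"
proof -
  note lc = assms(1) and td = assms(2) and m = assms(3) and lat = assms(4)
    and K = assms(5,6) and S = assms(7,8) and p = assms(9) and \<Omega> = assms(10)
    and int = assms(11)
  have G: "add_subgroup \<Gamma>" using lat by (simp add: lattice_subgroup_def)
  have cnt: "countable \<Gamma>" using countable_finitely_generated[OF S] .
  have sm: "sets m = sets borel" using left_haarD[OF m] by auto
  have \<Omega>_sets: "\<Omega> \<in> sets m" using \<Omega> by (simp add: borel_fundamental_domain_def sm)
  obtain L C where LC: "1 \<le> L" "0 \<le> C"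
    and und: "\<And>c. c \<in> \<Gamma> \<Longrightarrow> real (word_length S c) \<le> L * (real (word_length K c) + C)"
    using undistorted_word_length_le[OF assms(12) add_subgroupD(1)[OF G]] by blast
  define F where "F h = ennreal (real (word_length K h) powr p)" for h
  have F: "F \<in> borel_measurable borel"
    unfolding F_def
    by (rule measurable_compose[OF measurable_word_length[OF K(1)]]) simp
  have finF: "(\<integral>\<^sup>+h\<in>\<Omega>. F h \<partial>m) < \<infinity>"
    using int by (simp add: F_def)
  \<comment> \<open>Away from \<open>0\<close> the integrand is at least \<open>1\<close>, and the point \<open>0\<close> is compact.\<close>
  have fin\<Omega>: "emeasure m \<Omega> < \<infinity>"
  proof -
    have "indicator \<Omega> h \<le> F h * indicator \<Omega> h + indicator {0} h" for h
    proof (cases "h = 0")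
      case False
      then have "word_length K h \<noteq> 0"
        using word_length_eq_0D[OF K(2), of h] by auto
      then have "1 \<le> real (word_length K h) powr p"
        using p by (intro ge_one_powr_ge_zero) auto
      then have "1 \<le> F h" by (simp add: F_def)
      then show ?thesis by (auto simp: indicator_def)
    qed (auto simp: indicator_def)
    then have "emeasure m \<Omega> \<le> (\<integral>\<^sup>+h. F h * indicator \<Omega> h + indicator {0} h \<partial>m)"
      using nn_integral_mono[of m "indicator \<Omega>"] by (simp only: nn_integral_indicator[OF \<Omega>_sets])
    also have "\<dots> = (\<integral>\<^sup>+h\<in>\<Omega>. F h \<partial>m) + emeasure m {0}"
      using F \<Omega>_sets sm by (subst nn_integral_add) (auto simp: measurable_cong_sets[OF sm refl])
    also have "\<dots> < \<infinity>"
      using finF left_haarD(3)[OF m, of "{0}"] by simp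
    finally show ?thesis .
  qed
  have "(\<integral>\<^sup>+h\<in>\<Omega>. ennreal (real (word_length S (induction_cocycle \<Gamma> \<Omega> g h)) powr p) \<partial>m) < \<infinity>" for g
  proof -
    define \<alpha> where "\<alpha> = induction_cocycle \<Gamma> \<Omega> g"
    define D where "D = real (word_length K g) + C"
    define M where "M = L powr p * 3 powr p"
    have D: "0 \<le> D" and M: "0 \<le> M" using LC by (auto simp: D_def M_def)
    \<comment> \<open>The triangle inequality for \<open>\<alpha> h = - h + (- g + (g + h + \<alpha> h))\<close>; \<open>D\<close> collects what does not depend on \<open>h\<close>.\<close>
    have bound: "ennreal (real (word_length S (\<alpha> h)) powr p)
        \<le> ennreal M * (F h + F (g + h + \<alpha> h) + ennreal (D powr p))" for h
    proof -
      let ?a = "real (word_length K h)" and ?b = "real (word_length K (g + h + \<alpha> h))"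
      have \<alpha>: "\<alpha> h = - h + (- g + (g + h + \<alpha> h))"
        by (simp only: add.assoc minus_add_cancel)
      have "word_length K (\<alpha> h)
          \<le> word_length K (- h) + word_length K (- g + (g + h + \<alpha> h))"
        by (subst \<alpha>) (rule word_length_add[OF K(2) UNIV_I UNIV_I])
      also have "word_length K (- g + (g + h + \<alpha> h))
          \<le> word_length K (- g) + word_length K (g + h + \<alpha> h)"
        by (rule word_length_add[OF K(2) UNIV_I UNIV_I])
      finally have "word_length K (\<alpha> h)
          \<le> word_length K (- h) + (word_length K (- g) + word_length K (g + h + \<alpha> h))"
        by simp
      then have "real (word_length K (\<alpha> h)) + C \<le> ?a + ?b + D"
        using word_length_uminus[OF K(2), of h] word_length_uminus[OF K(2), of g]
        by (simp add: D_def)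
      then have "real (word_length S (\<alpha> h)) \<le> L * (?a + ?b + D)"
        using und[OF induction_cocycle_mem(1)[OF G \<Omega>], of g h] LC(1)
        unfolding \<alpha>_def[symmetric] by (meson mult_left_mono order_trans zero_le_one)
      then have "real (word_length S (\<alpha> h)) powr p \<le> (L * (?a + ?b + D)) powr p"
        using p by (intro powr_mono2) auto
      also have "\<dots> = L powr p * (?a + ?b + D) powr p"
        by (rule powr_mult)
      also have "\<dots> \<le> M * (?a powr p + ?b powr p + D powr p)"
        unfolding M_def mult.assoc using p D by (intro mult_left_mono powr_add3_le) auto
      finally show ?thesis
        using M by (simp add: F_def ennreal_mult'[symmetric] flip: ennreal_plus)
    qed
    have meas: "(\<lambda>h. F (g + h + \<alpha> h)) \<in> borel_measurable m"
    proof -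
      have "(\<lambda>h. F (g + h + \<alpha> h)) \<in> borel_measurable borel"
        unfolding \<alpha>_def
        by (rule measurable_compose_countable'[OF _ measurable_induction_cocycle[OF G cnt \<Omega>] cnt])
          (rule measurable_compose[OF measurable_translate F])
      then show ?thesis by (simp add: measurable_cong_sets[OF sm refl])
    qed
    have Fm: "F \<in> borel_measurable m" using F by (simp add: measurable_cong_sets[OF sm refl])
    have "(\<integral>\<^sup>+h\<in>\<Omega>. ennreal (real (word_length S (\<alpha> h)) powr p) \<partial>m)
        \<le> (\<integral>\<^sup>+h. ennreal M * (F h * indicator \<Omega> h + F (g + h + \<alpha> h) * indicator \<Omega> h
              + ennreal (D powr p) * indicator \<Omega> h) \<partial>m)"
      using bound by (intro nn_integral_mono) (auto simp: indicator_def)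
    also have "\<dots> = ennreal M * ((\<integral>\<^sup>+h\<in>\<Omega>. F h \<partial>m) + (\<integral>\<^sup>+h\<in>\<Omega>. F (g + h + \<alpha> h) \<partial>m)
          + ennreal (D powr p) * emeasure m \<Omega>)"
      using Fm meas \<Omega>_sets by (simp add: nn_integral_cmult nn_integral_add nn_integral_cmult_indicator)
    also have "(\<integral>\<^sup>+h\<in>\<Omega>. F (g + h + \<alpha> h) \<partial>m) = (\<integral>\<^sup>+h\<in>\<Omega>. F h \<partial>m)"
      unfolding \<alpha>_def by (rule nn_integral_induced_action[OF lc td m lat cnt \<Omega> F])
    also have "ennreal M * ((\<integral>\<^sup>+h\<in>\<Omega>. F h \<partial>m) + (\<integral>\<^sup>+h\<in>\<Omega>. F h \<partial>m)
          + ennreal (D powr p) * emeasure m \<Omega>) < \<infinity>"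
      using finF fin\<Omega> by (simp add: ennreal_mult_less_top)
    finally show ?thesis by (simp add: \<alpha>_def)
  qed
  then show ?thesis
    using \<Omega> unfolding p_integrable_def by blast
qed

end
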